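(* Let $n\ge 1$ and let $K_1,\dots,K_n$ be continua in $\mathbb{R}^n$, each containing the origin of $\mathbb{R}^n$. Assume that each continuum $K_i$ contains a point $e_i$ such that the vectors $e_1,\dots,e_n$ are linearly independent. Then the sum $K:=K_1+\dots+K_n$ has non-empty interior in $\mathbb{R}^n$, and the Lebesgue measure of $K$ is not smaller than the volume of the parallelotope $P:=[0,1]\cdot e_1+\dots+[0,1]\cdot e_n$.
   Context: A continuum is a connected compact metrizable space. Sums of sets are Minkowski (algebraic) sums: $K_1+\dots+K_n=\{x_1+\dots+x_n: x_i\in K_i\}$. Volume means $n$-dimensional Lebesgue measure. *)

theory Defs
  imports "HOL-Analysis.Analysis" "HOL-Library.Set_Algebras"
begin

definition continuum :: "'a topology \<Rightarrow> bool" where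
  "continuum X \<longleftrightarrow> connected_space X \<and> compact_space X \<and> metrizable_space X"

text \<open>On sets, \<open>+\<close> and \<open>\<Sum>\<close> are the Minkowski operations of Set_Algebras.\<close>

definition parallelotope :: "('i::finite \<Rightarrow> 'a::real_vector) \<Rightarrow> 'a set" where
  "parallelotope e = (\<Sum>i\<in>UNIV. (\<lambda>t. t *\<^sub>R e i) ` {0..1})"

end

theory Submission imports Defs
begin

text \<open>Let \<open>L\<close> be the lattice generated by the vectors \<open>e i\<close>. If each \<open>K i\<close> is a path from \<open>0\<close> to
  \<open>e i\<close>, the sum of the paths induces a self-map of the torus homotopic to the identity, hence
  onto, so the translates of the sum by \<open>L\<close> cover the space. A continuum is a limit of paths in
  its neighbourhoods, so by compactness the translates of the Minkowski sum by \<open>L\<close> cover in general.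
  Baire's theorem gives an interior point, and as the translates of the open parallelotope by
  \<open>L\<close> are disjoint, its volume is at most that of the sum.\<close>

section \<open>Periodic extension of a closed path\<close>

text \<open>Near an integer \<open>k\<close> the function is glued from the shifted copies of
  \<open>q\<close> on the two adjacent unit intervals. They match at \<open>k\<close> because
  \<open>q 0 = q 1\<close>, which also corrects the jump of \<open>frac\<close> there.\<close>

lemma continuous_on_periodic_extension:
  fixes q :: "real \<Rightarrow> 'a::topological_space"
  assumes cont: "continuous_on {0..1} q" and "q 0 = q 1"
  shows "continuous_on UNIV (\<lambda>t. q (frac t))"
proof -
  have "isCont (\<lambda>t. q (frac t)) t" for t :: real
  proof -
    define k where "k = \<lfloor>t\<rfloor>"
    let ?S = "{of_int k - 1..of_int k + 1 :: real}"
    have "continuous_on ?S (\<lambda>s. if s \<le> of_int k then q (s - of_int k + 1) else q (s - of_int k))"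
    proof (rule continuous_on_cases_le)
      show "continuous_on {s \<in> ?S. s \<le> of_int k} (\<lambda>s. q (s - of_int k + 1))"
        by (rule continuous_on_compose2[OF cont]) (auto intro!: continuous_intros)
      show "continuous_on {s \<in> ?S. of_int k \<le> s} (\<lambda>s. q (s - of_int k))"
        by (rule continuous_on_compose2[OF cont]) (auto intro!: continuous_intros)
    qed (use assms in \<open>auto intro!: continuous_intros\<close>)
    moreover have "(if s \<le> of_int k then q (s - of_int k + 1) else q (s - of_int k)) = q (frac s)"
      if "s \<in> ?S" for s
    proof -
      consider "s = of_int k - 1" | "of_int k - 1 < s" "s < of_int k" | "s = of_int k"
        | "of_int k < s" "s < of_int k + 1" | "s = of_int k + 1"
        using \<open>s \<in> ?S\<close> unfolding atLeastAtMost_iff by linarith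
      then show ?thesis
      proof cases
        case 2
        then have "frac s = s - of_int k + 1"
          by (simp add: frac_unique_iff)
        with 2 show ?thesis by simp
      next
        case 4
        then have "frac s = s - of_int k"
          by (simp add: frac_unique_iff)
        with 4 show ?thesis by simp
      qed (use \<open>q 0 = q 1\<close> in \<open>simp_all add: frac_def\<close>)
    qed
    ultimately have "continuous_on ?S (\<lambda>t. q (frac t))"
      by (rule continuous_on_eq)
    moreover have "t \<in> interior ?S"
      unfolding k_def interior_atLeastAtMost_real greaterThanLessThan_iff by linarith
    ultimately show ?thesis
      by (rule continuous_on_interior)
  qed
  then show ?thesis
    by (simp add: continuous_on_eq_continuous_at)
qed

section \<open>The lattice, and sums of paths modulo the lattice\<close>

text \<open>For linear \<open>f\<close> this is the additive group generated by the vectors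
  \<open>f (axis i 1)\<close>. Encoding the basis as a map reduces questions about the lattice to
  integer coordinates.\<close>

definition lattice :: "(real ^ 'n \<Rightarrow> real ^ 'n) \<Rightarrow> (real ^ 'n) set" where
  "lattice f = f ` {z. \<forall>i. z $ i \<in> \<int>}"

lemma countable_int_vectors: "countable {z :: real ^ 'n. \<forall>i. z $ i \<in> \<int>}"
proof -
  have "{z :: real ^ 'n. \<forall>i. z $ i \<in> \<int>} = range (\<lambda>k. \<chi> i. of_int (k i))"
  proof (intro equalityI subsetI)
    fix z :: "real ^ 'n" assume "z \<in> {z. \<forall>i. z $ i \<in> \<int>}"
    then show "z \<in> range (\<lambda>k. \<chi> i. of_int (k i))"
      by (intro image_eqI[where x = "\<lambda>i. \<lfloor>z $ i\<rfloor>"]) (simp_all add: vec_eq_iff)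
  qed auto
  then show ?thesis by simp
qed

lemma countable_lattice: "countable (lattice f)"
  unfolding lattice_def by (intro countable_image countable_int_vectors)

text \<open>Multiples of the all-ones vector suffice. Being infinite allows an enumeration of the
  lattice by \<open>nat\<close> without repetition in the volume comparison.\<close>

lemma infinite_lattice:
  assumes "inj f"
  shows "infinite (lattice f)"
proof -
  have "inj (\<lambda>n. f (vec (of_nat n)))"
    by (rule injI, drule injD[OF assms]) (simp add: vec_eq_iff)
  then have "infinite (range (\<lambda>n. f (vec (of_nat n))))"
    by (rule range_inj_infinite)
  moreover have "range (\<lambda>n. f (vec (of_nat n))) \<subseteq> lattice f"
    by (auto simp: lattice_def)
  ultimately show ?thesis by (rule infinite_super[rotated])
qed

lemma closed_lattice:
  assumes "linear f" "inj f"
  shows "closed (lattice f)"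
proof -
  have "{z :: real ^ 'a. \<forall>i. z $ i \<in> \<int>} = (\<Inter>i. (\<lambda>z. z $ i) -` \<int>)" by auto
  also have "closed \<dots>"
    by (intro closed_INT ballI closed_vimage closed_Ints continuous_intros)
  finally show ?thesis
    unfolding lattice_def by (rule closed_injective_linear_image[OF _ assms])
qed

text \<open>Extending each path periodically modulo its end point gives a map
  \<open>x \<mapsto> f x + r x\<close> with \<open>r\<close> bounded, which is onto by Brouwer's theorem applied to
  \<open>x \<mapsto> f\<inverse> (y - r x)\<close>.\<close>

lemma sum_paths_mod_lattice:
  fixes f :: "real ^ 'n \<Rightarrow> real ^ 'n" and g :: "'n \<Rightarrow> real \<Rightarrow> real ^ 'n"
  assumes f: "linear f" "inj f"
    and g: "\<And>i. path (g i)" "\<And>i. g i 0 = 0" "\<And>i. g i 1 = f (axis i 1)"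
  obtains t l where "\<And>i. t i \<in> {0..1}" "l \<in> lattice f" "y = (\<Sum>i\<in>UNIV. g i (t i)) + l"
proof -
  \<comment> \<open>The deviation of \<open>g i\<close> from the straight segment to its end point:
    it vanishes at 0 and 1, so its periodic extension is continuous.\<close>
  define q where "q i t = g i t - t *\<^sub>R f (axis i 1)" for i t
  define r where "r x = (\<Sum>i\<in>UNIV. q i (frac (x $ i)))" for x :: "real ^ 'n"
  have f_eq: "f x = (\<Sum>i\<in>UNIV. (x $ i) *\<^sub>R f (axis i 1))" for x
    by (subst basis_expansion[symmetric])
       (simp add: linear_sum[OF f(1)] linear_scale[OF f(1)] scalar_mult_eq_scaleR)
  have q: "continuous_on {0..1} (q i)" for i
    using g(1) unfolding q_def path_def by (intro continuous_intros) auto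
  have q_periodic: "continuous_on UNIV (\<lambda>t. q i (frac t))" for i
    by (rule continuous_on_periodic_extension[OF q]) (simp add: q_def g)
  have r: "continuous_on UNIV r"
    unfolding r_def
    by (intro continuous_on_sum continuous_on_compose2[OF q_periodic])
       (auto intro!: continuous_intros)
  have "bounded (\<Union>i. q i ` {0..1})"
    by (intro bounded_UN ballI compact_imp_bounded compact_continuous_image q) auto
  then obtain B where "\<forall>x\<in>\<Union>i. q i ` {0..1}. norm x \<le> B"
    unfolding bounded_iff by (elim exE)
  then have B: "norm (q i t) \<le> B" if "t \<in> {0..1}" for i t
    using that by blast
  have r_bound: "norm (r x) \<le> of_nat CARD('n) * B" for x
    unfolding r_def by (rule sum_norm_bound) (auto intro!: B simp: less_imp_le[OF frac_lt_1])
  obtain h where h: "linear h" "\<And>x. h (f x) = x" "\<And>x. f (h x) = x"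
    using linear_injective_isomorphism[OF f] by blast
  obtain D where D: "D > 0" "\<And>x. norm (h x) \<le> D * norm x"
    using linear_bounded_pos[OF h(1)] by blast
  \<comment> \<open>The first summand bounds \<open>h (y - r x)\<close> for every \<open>x\<close>;
    the 1 keeps the radius positive even if that bound is 0.\<close>
  define R where "R = D * (norm y + of_nat CARD('n) * B) + 1"
  have "B \<ge> 0" using B[of 0] norm_ge_zero by (meson atLeastAtMost_iff order_trans zero_le_one order_refl)
  then have "R > 0"
    unfolding R_def using D(1) by (intro add_nonneg_pos mult_nonneg_nonneg add_nonneg_nonneg) auto
  have "(\<lambda>x. h (y - r x)) \<in> cball 0 R \<rightarrow> cball 0 R"
  proof
    fix x
    have "norm (h (y - r x)) \<le> D * norm (y - r x)" by (rule D)
    also have "\<dots> \<le> D * (norm y + of_nat CARD('n) * B)"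
      using D(1) r_bound[of x] norm_triangle_ineq4[of y "r x"] by (intro mult_left_mono) auto
    finally show "h (y - r x) \<in> cball 0 R" by (simp add: R_def)
  qed
  moreover have "continuous_on (cball 0 R) (\<lambda>x. h (y - r x))"
    by (intro linear_continuous_on_compose[OF _ h(1)] continuous_intros continuous_on_subset[OF r]) auto
  ultimately obtain x where "h (y - r x) = x"
    using brouwer_ball[OF \<open>R > 0\<close>, of 0] by metis
  then have y: "y = f x + r x"
    using h(3)[of "y - r x"] by (simp add: algebra_simps)
  \<comment> \<open>The fractional parts of \<open>x\<close> become the path parameters, the integer
    parts the lattice vector.\<close>
  define z where "z = (\<chi> i. real_of_int \<lfloor>x $ i\<rfloor>)"
  have "f x + r x = (\<Sum>i\<in>UNIV. g i (frac (x $ i)) + (z $ i) *\<^sub>R f (axis i 1))"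
    unfolding r_def f_eq[of x] sum.distrib[symmetric]
    by (rule sum.cong) (auto simp: q_def z_def frac_def algebra_simps)
  also have "\<dots> = (\<Sum>i\<in>UNIV. g i (frac (x $ i))) + f z"
    by (simp add: sum.distrib f_eq[of z])
  finally show thesis
    using y by (intro that[of "\<lambda>i. frac (x $ i)" "f z"])
      (auto simp: lattice_def z_def less_imp_le[OF frac_lt_1])
qed

section \<open>From paths to continua\<close>

text \<open>\<open>K\<close> itself may contain no path from \<open>a\<close> to \<open>b\<close>,
  but its open \<epsilon>-neighbourhood is connected between them, and components of open sets are
  path components.\<close>

lemma path_near_connected:
  fixes K :: "'a::real_normed_vector set"
  assumes "connected K" "a \<in> K" "b \<in> K" "\<epsilon> > 0"
  obtains g where "path g" "g 0 = a" "g 1 = b"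
    "\<And>t. t \<in> {0..1} \<Longrightarrow> \<exists>k\<in>K. dist k (g t) < \<epsilon>"
proof -
  let ?U = "\<Union>k\<in>K. ball k \<epsilon>"
  have "K \<subseteq> ?U" using \<open>\<epsilon> > 0\<close> by auto
  then have "connected_component ?U a b"
    unfolding connected_component_def using assms by blast
  then have "path_component ?U a b"
    by (subst open_path_connected_component) auto
  then obtain g where g: "path g" "path_image g \<subseteq> ?U" "g 0 = a" "g 1 = b"
    unfolding path_component_def pathstart_def pathfinish_def by blast
  have "\<exists>k\<in>K. dist k (g t) < \<epsilon>" if "t \<in> {0..1}" for t
  proof -
    have "g t \<in> ?U" using g(2) that unfolding path_image_def by blast
    then show ?thesis by simp
  qed
  with g show thesis by (intro that)
qed

lemma compact_set_sum:
  fixes K :: "'i \<Rightarrow> 'a::real_normed_vector set"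
  assumes "\<And>i. i \<in> I \<Longrightarrow> compact (K i)"
  shows "compact (\<Sum>i\<in>I. K i)"
  using assms
proof (induction I rule: infinite_finite_induct)
  case (insert i I)
  have "K i + (\<Sum>i\<in>I. K i) = {x + y | x y. x \<in> K i \<and> y \<in> (\<Sum>i\<in>I. K i)}"
    by (auto simp: set_plus_def)
  with insert show ?case by (simp add: compact_sums)
qed simp_all

text \<open>A closed set plus a compact set is closed, so density of the union suffices. For
  density, each \<open>K i\<close> is replaced by a path close to it.\<close>

lemma sum_continua_mod_lattice:
  fixes f :: "real ^ 'n \<Rightarrow> real ^ 'n" and K :: "'n \<Rightarrow> (real ^ 'n) set"
  assumes f: "linear f" "inj f"
    and K: "\<And>i. connected (K i)" "\<And>i. compact (K i)" "\<And>i. 0 \<in> K i" "\<And>i. f (axis i 1) \<in> K i"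
  shows "(\<Union>l\<in>lattice f. (+) l ` (\<Sum>i\<in>UNIV. K i)) = UNIV"
proof -
  let ?C = "\<Sum>i\<in>UNIV. K i"
  have "closed (\<Union>l\<in>lattice f. \<Union>c\<in>?C. {l + c})"
    by (intro closed_compact_sums closed_lattice f compact_set_sum K)
  also have eq: "(\<Union>l\<in>lattice f. \<Union>c\<in>?C. {l + c}) = (\<Union>l\<in>lattice f. (+) l ` ?C)" by auto
  finally have closed: "closed \<dots>" .
  have "y \<in> closure (\<Union>l\<in>lattice f. (+) l ` ?C)" for y
    unfolding closure_approachable
  proof (intro allI impI)
    fix \<epsilon> :: real assume "\<epsilon> > 0"
    \<comment> \<open>One error below \<delta> for each of the \<open>CARD('n)\<close> summands adds
      up to less than \<epsilon>.\<close>
    define \<delta> where "\<delta> = \<epsilon> / of_nat CARD('n)"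
    have "\<delta> > 0" using \<open>\<epsilon> > 0\<close> by (simp add: \<delta>_def)
    then have "\<exists>g. path g \<and> g 0 = 0 \<and> g 1 = f (axis i 1) \<and> (\<forall>t\<in>{0..1}. \<exists>k\<in>K i. dist k (g t) < \<delta>)" for i
      using path_near_connected[OF K(1,3,4)] by metis
    then obtain g where g: "\<And>i. path (g i)" "\<And>i. g i 0 = 0" "\<And>i. g i 1 = f (axis i 1)"
      "\<And>i t. t \<in> {0..1} \<Longrightarrow> \<exists>k\<in>K i. dist k (g i t) < \<delta>"
      by metis
    obtain t l where t: "\<And>i. t i \<in> {0..1}" and l: "l \<in> lattice f"
      and y: "y = (\<Sum>i\<in>UNIV. g i (t i)) + l"
      using sum_paths_mod_lattice[OF f g(1-3)] by metis
    have "\<forall>i. \<exists>k. k \<in> K i \<and> dist k (g i (t i)) < \<delta>"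
      using g(4) t by blast
    then obtain k where k: "\<And>i. k i \<in> K i" "\<And>i. dist (k i) (g i (t i)) < \<delta>"
      by metis
    have "dist (l + sum k UNIV) y = norm (\<Sum>i\<in>UNIV. k i - g i (t i))"
      by (simp add: y dist_norm sum_subtractf)
    also have "\<dots> \<le> (\<Sum>i\<in>UNIV. norm (k i - g i (t i)))" by (rule norm_sum)
    also have "\<dots> < (\<Sum>i\<in>(UNIV :: 'n set). \<delta>)"
      using k(2) by (intro sum_strict_mono) (auto simp: dist_norm)
    also have "\<dots> = \<epsilon>" by (simp add: \<delta>_def)
    finally have "dist (l + sum k UNIV) y < \<epsilon>" .
    moreover have "sum k UNIV \<in> ?C"
      using k(1) by (auto simp: set_sum_alt)
    ultimately show "\<exists>x\<in>\<Union>l\<in>lattice f. (+) l ` ?C. dist x y < \<epsilon>"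
      using l by blast
  qed
  then show ?thesis using closed by auto
qed

section \<open>Volume and interior of a set whose translates cover\<close>

text \<open>Cut \<open>Q\<close> along the translates of \<open>C\<close> and move each piece back
  into \<open>C\<close>; by \<open>disj\<close> the pieces do not overlap there.\<close>

lemma emeasure_le_if_translates_cover:
  fixes C Q L :: "'a::euclidean_space set"
  assumes L: "countable L" "infinite L"
    and meas: "C \<in> sets lebesgue" "Q \<in> sets lebesgue"
    and cover: "Q \<subseteq> (\<Union>l\<in>L. (+) l ` C)"
    and disj: "\<And>l m a b. \<lbrakk>l \<in> L; m \<in> L; a \<in> Q; b \<in> Q; a - l = b - m\<rbrakk> \<Longrightarrow> l = m"
  shows "emeasure lebesgue Q \<le> emeasure lebesgue C"
proof -
  have translation: "emeasure lebesgue ((+) a ` S) = emeasure lebesgue S" for a :: 'a and S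
    using emeasure_lebesgue_affine[of 1 a S] by (simp add: ac_simps cong: image_cong_simp)
  define v where "v = from_nat_into L"
  have v: "inj v" "range v = L"
    using bij_betw_from_nat_into[OF L] by (auto simp: v_def bij_betw_def)
  \<comment> \<open>The part of \<open>C\<close> that translation by \<open>v n\<close> carries into
    \<open>Q\<close>.\<close>
  define A where "A n = C \<inter> (+) (- v n) ` Q" for n
  have A: "range A \<subseteq> sets lebesgue"
    unfolding A_def using meas by (intro image_subsetI sets.Int lebesgue_sets_translation)
  have "disjoint_family A"
    unfolding disjoint_family_on_def
  proof (intro ballI impI)
    fix m n :: nat assume "m \<noteq> n"
    have False if x: "x \<in> A m" "x \<in> A n" for x
    proof -
      obtain a b where "a \<in> Q" "b \<in> Q" "x = - v m + a" "x = - v n + b"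
        using x unfolding A_def by blast
      then have "v m = v n" using disj[of "v m" "v n" a b] v(2) by (auto simp: algebra_simps)
      with \<open>m \<noteq> n\<close> v(1) show False by (simp add: inj_eq)
    qed
    then show "A m \<inter> A n = {}" by blast
  qed
  have "Q = (\<Union>n. (+) (v n) ` A n)"
  proof
    show "(\<Union>n. (+) (v n) ` A n) \<subseteq> Q" by (auto simp: A_def)
    show "Q \<subseteq> (\<Union>n. (+) (v n) ` A n)"
    proof
      fix x assume "x \<in> Q"
      with cover obtain l c where "l \<in> L" "c \<in> C" "x = l + c" by auto
      moreover obtain n where "l = v n" using v(2) \<open>l \<in> L\<close> by auto
      ultimately have "c \<in> A n" using \<open>x \<in> Q\<close> by (auto simp: A_def image_iff intro!: bexI[of _ x])
      with \<open>x = l + c\<close> \<open>l = v n\<close> show "x \<in> (\<Union>n. (+) (v n) ` A n)" by auto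
    qed
  qed
  then have "emeasure lebesgue Q = emeasure lebesgue (\<Union>n. (+) (v n) ` A n)" by simp
  \<comment> \<open>The pieces may overlap inside \<open>Q\<close>, so this is only an inequality;
    disjointness of the \<open>A n\<close> gives equality once they are moved back.\<close>
  also have "\<dots> \<le> (\<Sum>n. emeasure lebesgue ((+) (v n) ` A n))"
    using A by (intro emeasure_subadditive_countably image_subsetI lebesgue_sets_translation) auto
  also have "\<dots> = (\<Sum>n. emeasure lebesgue (A n))"
    by (simp add: translation)
  also have "\<dots> = emeasure lebesgue (\<Union>n. A n)"
    using A \<open>disjoint_family A\<close> by (rule suminf_emeasure)
  also have "\<dots> \<le> emeasure lebesgue C"
    using meas(1) by (intro emeasure_mono) (auto simp: A_def)
  finally show ?thesis .
qed

text \<open>Otherwise the whole space would be a countable union of closed sets with empty interior,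
  against Baire's theorem.\<close>

lemma interior_nonempty_if_translates_cover:
  fixes C L :: "'a::euclidean_space set"
  assumes "countable L" "closed C" and cover: "(\<Union>l\<in>L. (+) l ` C) = UNIV"
  shows "interior C \<noteq> {}"
proof
  assume "interior C = {}"
  then have "euclidean interior_of \<Union>((\<lambda>l. (+) l ` C) ` L) = {}"
    using assms(1,2)
    by (intro Baire_category_alt) (auto simp: completely_metrizable_space_euclidean
        closed_translation interior_translation)
  with cover show False by simp
qed

text \<open>The frontier of a convex set is negligible. This allows passing to the open
  parallelotope.\<close>

lemma emeasure_convex_interior:
  fixes S :: "'a::euclidean_space set"
  assumes "convex S"
  shows "emeasure lebesgue (interior S) = emeasure lebesgue S"
proof -
  have "S - interior S \<subseteq> frontier S"
    using closure_subset by (auto simp: frontier_def)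
  then have "S - interior S \<in> null_sets lebesgue"
    using assms negligible_convex_frontier negligible_subset negligible_iff_null_sets by blast
  then have "emeasure lebesgue (interior S \<union> (S - interior S)) = emeasure lebesgue (interior S)"
    by (intro emeasure_Un_null_set) auto
  moreover have "interior S \<union> (S - interior S) = S"
    using interior_subset by blast
  ultimately show ?thesis by simp
qed

theorem theorem4:
  fixes K :: "'n::finite \<Rightarrow> (real ^ 'n) set" and e :: "'n \<Rightarrow> real ^ 'n"
  assumes "\<And>i. continuum (top_of_set (K i))"
    and "\<And>i. 0 \<in> K i"
    and "\<And>i. e i \<in> K i"
    and "inj e" and "independent (range e)"
  shows "interior (\<Sum>i\<in>UNIV. K i) \<noteq> {} \<and>
    emeasure lebesgue (\<Sum>i\<in>UNIV. K i) \<ge> emeasure lebesgue (parallelotope e)"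
proof -
  \<comment> \<open>\<open>f\<close> maps the standard basis to the \<open>e i\<close>, so the
    lattice is generated by the \<open>e i\<close> and the parallelotope is the image of the unit
    cube.\<close>
  define f where "f x = (\<Sum>i\<in>UNIV. (x $ i) *\<^sub>R e i)" for x :: "real ^ 'n"
  define C where "C = (\<Sum>i\<in>UNIV. K i)"
  have f: "linear f"
    unfolding f_def by (rule linearI) (simp_all add: algebra_simps sum.distrib scaleR_sum_right)
  have "x = 0" if "f x = 0" for x
  proof -
    \<comment> \<open>\<open>independent\<close> concerns a set of vectors, so the sum is reindexed
      from \<open>i\<close> to \<open>e i\<close>, using injectivity of \<open>e\<close>.\<close>
    have "(\<Sum>v\<in>range e. (x $ inv e v) *\<^sub>R v) = 0"
      using that \<open>inj e\<close> by (simp add: f_def sum.reindex)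
    then have "x $ inv e (e i) = 0" for i
      using independentD[OF \<open>independent (range e)\<close>, of "range e" "\<lambda>v. x $ inv e v" "e i"] by auto
    then show "x = 0" using \<open>inj e\<close> by (simp add: vec_eq_iff)
  qed
  then have "inj f" using linear_injective_0[OF f] by blast
  have f_axis: "f (axis i 1) = e i" for i
    by (simp add: f_def axis_def if_distrib[where f = "\<lambda>c. c *\<^sub>R _"] cong: if_cong)
  have K: "connected (K i)" "compact (K i)" for i
    using assms(1)[of i] unfolding continuum_def
    by (simp_all add: connectedin_def compactin_subspace
        flip: connectedin_iff_connected compactin_euclidean_iff)
  have "compact C" unfolding C_def by (intro compact_set_sum K)
  have cover: "(\<Union>l\<in>lattice f. (+) l ` C) = UNIV"
    unfolding C_def using assms(2,3) by (intro sum_continua_mod_lattice f \<open>inj f\<close> K) (simp_all add: f_axis)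
  have P: "parallelotope e = f ` cbox 0 1"
  proof (intro equalityI subsetI)
    fix x assume "x \<in> parallelotope e"
    then obtain s where s: "x = sum s UNIV" "\<And>i. s i \<in> (\<lambda>t. t *\<^sub>R e i) ` {0..1}"
      unfolding parallelotope_def set_sum_alt[OF finite] by blast
    then have "\<forall>i. \<exists>t. t \<in> {0..1} \<and> s i = t *\<^sub>R e i" by blast
    then obtain t where t: "\<And>i. t i \<in> {0..1}" "\<And>i. s i = t i *\<^sub>R e i"
      by metis
    have "x = f (\<chi> i. t i)" by (simp add: s t f_def)
    then show "x \<in> f ` cbox 0 1"
      using t(1) by (auto simp: mem_box_cart)
  next
    fix x assume "x \<in> f ` cbox 0 1"
    then obtain u where u: "x = f u" "\<And>i. u $ i \<in> {0..1}"
      by (auto simp: mem_box_cart)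
    then have "\<forall>i. (u $ i) *\<^sub>R e i \<in> (\<lambda>t. t *\<^sub>R e i) ` {0..1}" by blast
    then show "x \<in> parallelotope e"
      unfolding parallelotope_def set_sum_alt[OF finite] u(1) f_def by blast
  qed
  \<comment> \<open>Lattice translates of the closed parallelotope share faces, so disjointness
    requires the interior.\<close>
  have "emeasure lebesgue (parallelotope e) = emeasure lebesgue (interior (f ` cbox 0 1))"
    unfolding P
    by (intro emeasure_convex_interior[symmetric] convex_linear_image f convex_box)
  also have interior_P: "interior (f ` cbox 0 1) = f ` box 0 1"
    by (simp add: interior_injective_linear_image f \<open>inj f\<close> interior_cbox)
  also have "emeasure lebesgue (f ` box 0 1) \<le> emeasure lebesgue C"
  proof (rule emeasure_le_if_translates_cover)
    show "C \<in> sets lebesgue" using \<open>compact C\<close> by (intro fmeasurableD lmeasurable_compact)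
    show "f ` box 0 1 \<in> sets lebesgue"
      unfolding interior_P[symmetric] by simp
    fix l m a b
    assume "l \<in> lattice f" "m \<in> lattice f" "a \<in> f ` box 0 1" "b \<in> f ` box 0 1" and eq: "a - l = b - m"
    then obtain z w u v where zw: "l = f z" "m = f w" "\<And>i. z $ i \<in> \<int>" "\<And>i. w $ i \<in> \<int>"
      and uv: "a = f u" "b = f v" "u \<in> box 0 1" "v \<in> box 0 1"
      by (auto simp: lattice_def)
    have "f (u - z) = f (v - w)" using eq by (simp add: zw uv linear_diff[OF f])
    then have "u - z = v - w" using \<open>inj f\<close> by (simp add: inj_eq)
    \<comment> \<open>Coordinates of two points of the open unit cube differ by less than 1, and
      here the difference is an integer.\<close>
    have "z $ i = w $ i" for i
    proof (rule Ints_eq_abs_less1[THEN iffD2])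
      have "z $ i - w $ i = u $ i - v $ i"
        using \<open>u - z = v - w\<close> by (simp add: vec_eq_iff algebra_simps)
      moreover have "0 < u $ i" "u $ i < 1" "0 < v $ i" "v $ i < 1"
        using uv(3,4) by (auto simp: mem_box_cart)
      ultimately show "\<bar>z $ i - w $ i\<bar> < 1" by linarith
    qed (rule zw)+
    then have "z = w" by (simp add: vec_eq_iff)
    then show "l = m" by (simp add: zw)
  qed (simp_all add: cover countable_lattice infinite_lattice \<open>inj f\<close>)
  finally have "emeasure lebesgue (parallelotope e) \<le> emeasure lebesgue C" .
  moreover have "interior C \<noteq> {}"
    using countable_lattice compact_imp_closed[OF \<open>compact C\<close>] cover
    by (rule interior_nonempty_if_translates_cover)
  ultimately show ?thesis by (simp add: C_def)
qed

end
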